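(* Let $G$ be a connected topological group, let $\mathcal{H}$ be a complex Hilbert space and let $\pi\colon G \to \mathrm{PU}(\mathcal{H})$ be a projective unitary representation, i.e. a group homomorphism (not assumed continuous). Suppose that there is a cyclic ray $[v] \in \mathbb{P}(\mathcal{H})$ whose orbit map $G \to \mathbb{P}(\mathcal{H})$, $g \mapsto \pi(g)[v]$, is continuous. Then $\pi$ is continuous.
   Context: $\mathrm{U}(\mathcal{H})$ carries the strong operator topology, $\mathbb{T} = \{z\in\mathbb{C} : |z|=1\}$, and $\mathrm{PU}(\mathcal{H}) = \mathrm{U}(\mathcal{H})/\mathbb{T}\mathbf{1}$ carries the quotient topology. $\mathbb{P}(\mathcal{H})$ is the projective space of one-dimensional subspaces (rays) $[v] = \mathbb{C}v$, $0\neq v\in\mathcal{H}$, with the quotient topology from the unit sphere $\mathbb{S}(\mathcal{H})$ (norm topology), $\mathbb{P}(\mathcal{H})\cong\mathbb{S}(\mathcal{H})/\mathbb{T}$. $\mathrm{PU}(\mathcal{H})$ acts on $\mathbb{P}(\mathcal{H})$ in the natural way. A ray $[v]$ is cyclic for $\pi$ if the rays in $\pi(G)[v]$ span a dense linear subspace of $\mathcal{H}$. *)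

theory Defs
  imports "HOL-Analysis.Analysis" "HOL-Algebra.Coset"
begin

(* The topology is not required to be Hausdorff. *)
locale topological_group = group G for G :: "('g, 'm) monoid_scheme" (structure) +
  fixes T :: "'g topology"
  assumes topspace_eq_carrier: "topspace T = carrier G"
    and continuous_mult: "continuous_map (prod_topology T T) T (\<lambda>(x, y). x \<otimes> y)"
    and continuous_inv: "continuous_map T T (\<lambda>x. inv x)"

definition quotient_topology :: "'a topology \<Rightarrow> ('a \<Rightarrow> 'b) \<Rightarrow> 'b topology" where
  "quotient_topology X f =
     topology (\<lambda>S. S \<subseteq> f ` topspace X \<and> openin X {x \<in> topspace X. f x \<in> S})"

lemma openin_quotient_topology:
  "openin (quotient_topology X f) S \<longleftrightarrow>
     S \<subseteq> f ` topspace X \<and> openin X {x \<in> topspace X. f x \<in> S}"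
proof -
  have "istopology (\<lambda>S. S \<subseteq> f ` topspace X \<and> openin X {x \<in> topspace X. f x \<in> S})"
    unfolding istopology_def
  proof (intro conjI allI impI)
    fix S U
    assume S: "S \<subseteq> f ` topspace X \<and> openin X {x \<in> topspace X. f x \<in> S}"
      and U: "U \<subseteq> f ` topspace X \<and> openin X {x \<in> topspace X. f x \<in> U}"
    show "S \<inter> U \<subseteq> f ` topspace X" using S by blast
    have "{x \<in> topspace X. f x \<in> S \<inter> U}
        = {x \<in> topspace X. f x \<in> S} \<inter> {x \<in> topspace X. f x \<in> U}" by auto
    then show "openin X {x \<in> topspace X. f x \<in> S \<inter> U}"
      using S U by (simp add: openin_Int)
  next
    fix K
    assume K: "\<forall>S\<in>K. S \<subseteq> f ` topspace X \<and> openin X {x \<in> topspace X. f x \<in> S}"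
    then show "\<Union> K \<subseteq> f ` topspace X" by blast
    have "{x \<in> topspace X. f x \<in> \<Union> K} = \<Union> ((\<lambda>S. {x \<in> topspace X. f x \<in> S}) ` K)" by auto
    moreover have "openin X (\<Union> ((\<lambda>S. {x \<in> topspace X. f x \<in> S}) ` K))"
      using K by (intro openin_Union) blast
    ultimately show "openin X {x \<in> topspace X. f x \<in> \<Union> K}" by (simp only:)
  qed
  then show ?thesis by (simp add: quotient_topology_def topology_inverse')
qed

lemma topspace_quotient_topology: "topspace (quotient_topology X f) = f ` topspace X"
proof -
  have "{x \<in> topspace X. f x \<in> f ` topspace X} = topspace X" by auto
  then have "openin (quotient_topology X f) (f ` topspace X)"
    by (simp add: openin_quotient_topology)
  then show ?thesis
    by (metis openin_quotient_topology openin_subset openin_topspace subset_antisym)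
qed

lemma quotient_map_quotient_topology: "quotient_map X (quotient_topology X f) f"
  by (auto simp: quotient_map_def topspace_quotient_topology openin_quotient_topology)

(* The norm and the metric come from the real inner product, which is the real part of
   the complex one. The complex inner product is linear in the second argument. *)
class complex_hilbert_space = real_inner + complete_space +
  fixes scaleC :: "complex \<Rightarrow> 'a \<Rightarrow> 'a" (infixr "*\<^sub>C" 75)
    and cinner :: "'a \<Rightarrow> 'a \<Rightarrow> complex"
  assumes scaleC_add_right: "c *\<^sub>C (x + y) = c *\<^sub>C x + c *\<^sub>C y"
    and scaleC_add_left: "(c + d) *\<^sub>C x = c *\<^sub>C x + d *\<^sub>C x"
    and scaleC_scaleC: "c *\<^sub>C (d *\<^sub>C x) = (c * d) *\<^sub>C x"
    and scaleC_of_real: "complex_of_real r *\<^sub>C x = r *\<^sub>R x"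
    and cinner_commute: "cinner y x = cnj (cinner x y)"
    and cinner_add_right: "cinner x (y + z) = cinner x y + cinner x z"
    and cinner_scaleC_right: "cinner x (c *\<^sub>C y) = c * cinner x y"
    and Re_cinner: "Re (cinner x y) = inner x y"

lemma scaleC_one: "1 *\<^sub>C x = (x :: 'h::complex_hilbert_space)"
  using scaleC_of_real[of 1 x] by simp

global_interpretation complex_vector:
  vector_space "scaleC :: complex \<Rightarrow> 'h \<Rightarrow> 'h::complex_hilbert_space"
  by unfold_locales (simp_all add: scaleC_add_right scaleC_add_left scaleC_scaleC scaleC_one)

definition unitary_operators :: "('h \<Rightarrow>\<^sub>L 'h::complex_hilbert_space) set" where
  "unitary_operators =
     {u. (\<forall>c x. blinfun_apply u (c *\<^sub>C x) = c *\<^sub>C blinfun_apply u x) \<and>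
         (\<forall>x y. cinner (blinfun_apply u x) (blinfun_apply u y) = cinner x y) \<and>
         surj (blinfun_apply u)}"

definition unitary_group :: "('h \<Rightarrow>\<^sub>L 'h::complex_hilbert_space) monoid" where
  "unitary_group = \<lparr>carrier = unitary_operators, mult = (o\<^sub>L), one = id_blinfun\<rparr>"

definition unitary_topology :: "('h \<Rightarrow>\<^sub>L 'h::complex_hilbert_space) topology" where
  "unitary_topology = subtopology strong_operator_topology unitary_operators"

definition unitary_scalars :: "('h \<Rightarrow>\<^sub>L 'h::complex_hilbert_space) set" where
  "unitary_scalars = {u. \<exists>z. cmod z = 1 \<and> (\<forall>x. blinfun_apply u x = z *\<^sub>C x)}"

definition projective_unitary_group :: "('h \<Rightarrow>\<^sub>L 'h::complex_hilbert_space) set monoid" where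
  "projective_unitary_group = unitary_group Mod unitary_scalars"

definition projective_unitary_topology :: "('h \<Rightarrow>\<^sub>L 'h::complex_hilbert_space) set topology" where
  "projective_unitary_topology =
     quotient_topology unitary_topology (\<lambda>u. unitary_scalars #>\<^bsub>unitary_group\<^esub> u)"

definition ray :: "'h::complex_hilbert_space \<Rightarrow> 'h set" where
  "ray v = range (\<lambda>c. c *\<^sub>C v)"

definition projective_space :: "'h::complex_hilbert_space set set" where
  "projective_space = ray ` (- {0})"

definition projective_space_topology :: "'h::complex_hilbert_space set topology" where
  "projective_space_topology = quotient_topology (top_of_set (sphere 0 1)) ray"

(* An element of PU(H) is a coset A; all u in A map a given ray onto the same ray, so this
   union is just the image of the ray under any representative of A. *)
definition projective_action ::
    "('h \<Rightarrow>\<^sub>L 'h) set \<Rightarrow> 'h set \<Rightarrow> 'h::complex_hilbert_space set" where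
  "projective_action A l = (\<Union>u\<in>A. blinfun_apply u ` l)"

definition cyclic_ray ::
    "('g, 'm) monoid_scheme \<Rightarrow> ('g \<Rightarrow> ('h \<Rightarrow>\<^sub>L 'h) set) \<Rightarrow> 'h::complex_hilbert_space set \<Rightarrow> bool" where
  "cyclic_ray G \<pi> l \<longleftrightarrow>
     closure (complex_vector.span (\<Union>g\<in>carrier G. projective_action (\<pi> g) l)) = UNIV"

lemma norm_unitary:
  assumes "u \<in> unitary_operators"
  shows "norm (blinfun_apply u x) = norm x"
proof -
  have "cinner (blinfun_apply u x) (blinfun_apply u x) = cinner x x"
    using assms by (simp add: unitary_operators_def)
  then have "inner (blinfun_apply u x) (blinfun_apply u x) = inner x x"
    by (metis Re_cinner)
  then show ?thesis by (simp add: norm_eq_sqrt_inner)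
qed

lemma cinner_scaleC_left:
  "cinner (c *\<^sub>C x) y = cnj c * cinner x (y :: 'h::complex_hilbert_space)"
  by (metis cinner_commute cinner_scaleC_right complex_cnj_mult)

lemma unitary_inverse_exists:
  fixes u :: "'h \<Rightarrow>\<^sub>L 'h::complex_hilbert_space"
  assumes u: "u \<in> unitary_operators"
  shows "\<exists>w\<in>unitary_operators. w o\<^sub>L u = id_blinfun"
proof -
  have lin: "blinfun_apply u (c *\<^sub>C x) = c *\<^sub>C blinfun_apply u x" for c x
    using u by (simp add: unitary_operators_def)
  have iso: "cinner (blinfun_apply u x) (blinfun_apply u y) = cinner x y" for x y
    using u by (simp add: unitary_operators_def)
  have surj: "surj (blinfun_apply u)"
    using u by (simp add: unitary_operators_def)
  have inj: "inj (blinfun_apply u)"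
  proof (rule injI)
    fix x y assume "blinfun_apply u x = blinfun_apply u y"
    then have "norm (blinfun_apply u (x - y)) = 0" by (simp add: blinfun.diff_right)
    then show "x = y" by (simp add: norm_unitary[OF u])
  qed
  define f where "f = inv_into UNIV (blinfun_apply u)"
  have uf: "blinfun_apply u (f x) = x" for x
    unfolding f_def by (rule surj_f_inv_f[OF surj])
  have fu: "f (blinfun_apply u x) = x" for x
    unfolding f_def by (rule inv_f_f[OF inj])
  have bl: "bounded_linear f"
  proof (rule bounded_linear_intro[where K = 1])
    show "f (x + y) = f x + f y" for x y by (metis blinfun.add_right fu uf)
    show "f (r *\<^sub>R x) = r *\<^sub>R f x" for r x by (metis blinfun.scaleR_right fu uf)
    show "norm (f x) \<le> norm x * 1" for x by (metis norm_unitary[OF u] uf mult.right_neutral order_refl)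
  qed
  have app: "blinfun_apply (Blinfun f) = f" by (rule bounded_linear_Blinfun_apply[OF bl])
  have "Blinfun f \<in> unitary_operators"
    unfolding unitary_operators_def mem_Collect_eq app
  proof (intro conjI allI)
    show "f (c *\<^sub>C x) = c *\<^sub>C f x" for c x by (metis fu lin uf)
    show "cinner (f x) (f y) = cinner x y" for x y by (metis iso uf)
    show "surj f" by (metis fu surjI)
  qed
  moreover have "Blinfun f o\<^sub>L u = id_blinfun"
    by (rule blinfun_eqI) (simp add: app fu)
  ultimately show ?thesis by blast
qed

lemma group_unitary_group: "group (unitary_group :: ('h \<Rightarrow>\<^sub>L 'h::complex_hilbert_space) monoid)"
proof (rule groupI)
  fix x y :: "'h \<Rightarrow>\<^sub>L 'h"
  assume "x \<in> carrier unitary_group" "y \<in> carrier unitary_group"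
  moreover from this have "surj (blinfun_apply x \<circ> blinfun_apply y)"
    by (intro comp_surj) (simp_all add: unitary_group_def unitary_operators_def)
  ultimately show "x \<otimes>\<^bsub>unitary_group\<^esub> y \<in> carrier unitary_group"
    by (simp add: unitary_group_def unitary_operators_def comp_def)
next
  fix x :: "'h \<Rightarrow>\<^sub>L 'h"
  assume "x \<in> carrier unitary_group"
  then show "\<exists>y\<in>carrier unitary_group. y \<otimes>\<^bsub>unitary_group\<^esub> x = \<one>\<^bsub>unitary_group\<^esub>"
    using unitary_inverse_exists by (simp add: unitary_group_def)
qed (auto simp: unitary_group_def unitary_operators_def intro!: blinfun_eqI)

lemma bounded_linear_scaleC: "bounded_linear (\<lambda>x :: 'h::complex_hilbert_space. z *\<^sub>C x)"
proof (rule bounded_linear_intro[where K = "cmod z"])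
  show "z *\<^sub>C (r *\<^sub>R x) = r *\<^sub>R (z *\<^sub>C x)" for r and x :: 'h
    by (simp add: scaleC_of_real[symmetric] scaleC_scaleC mult.commute)
  show "norm (z *\<^sub>C x) \<le> norm x * cmod z" for x :: 'h
  proof -
    have "cinner (z *\<^sub>C x) (z *\<^sub>C x) = complex_of_real ((cmod z)\<^sup>2) * cinner x x"
      by (simp add: cinner_scaleC_left cinner_scaleC_right complex_norm_square mult.assoc
          del: of_real_power)
    then have "Re (cinner (z *\<^sub>C x) (z *\<^sub>C x)) = (cmod z)\<^sup>2 * Re (cinner x x)"
      by (simp only: times_complex.sel Re_complex_of_real Im_complex_of_real mult_zero_left diff_zero)
    then have "(norm (z *\<^sub>C x))\<^sup>2 = (norm x * cmod z)\<^sup>2"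
      by (simp add: Re_cinner power2_norm_eq_inner power_mult_distrib mult.commute)
    then show ?thesis by (simp add: power2_eq_iff_nonneg)
  qed
qed (simp add: scaleC_add_right)

lemma unitary_scalars_subset:
  "unitary_scalars \<subseteq> (unitary_operators :: ('h \<Rightarrow>\<^sub>L 'h::complex_hilbert_space) set)"
proof
  fix u :: "'h \<Rightarrow>\<^sub>L 'h"
  assume "u \<in> unitary_scalars"
  then obtain z where z: "cmod z = 1" and u: "\<And>x. blinfun_apply u x = z *\<^sub>C x"
    by (auto simp: unitary_scalars_def)
  have zz: "cnj z * z = 1"
    by (metis z complex_norm_square mult.commute of_real_1 power_one)
  have "surj (blinfun_apply u)"
    by (rule surjI[where f = "\<lambda>x. cnj z *\<^sub>C x"])
      (simp add: u scaleC_scaleC mult.commute[of z] zz scaleC_one)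
  moreover have "cinner (z *\<^sub>C x) (z *\<^sub>C y) = cinner x y" for x y :: 'h
    by (simp add: cinner_scaleC_left cinner_scaleC_right mult.assoc[symmetric] zz mult.commute[of z])
  ultimately show "u \<in> unitary_operators"
    by (simp add: unitary_operators_def u scaleC_scaleC mult.commute)
qed

lemma normal_unitary_scalars:
  "unitary_scalars \<lhd> (unitary_group :: ('h \<Rightarrow>\<^sub>L 'h::complex_hilbert_space) monoid)"
proof -
  interpret U: group "unitary_group :: ('h \<Rightarrow>\<^sub>L 'h) monoid" by (rule group_unitary_group)
  have conj: "w o\<^sub>L h o\<^sub>L w' \<in> unitary_scalars"
    if "w \<in> unitary_operators" "h \<in> unitary_scalars" "w o\<^sub>L w' = id_blinfun"
    for w h w' :: "'h \<Rightarrow>\<^sub>L 'h"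
  proof -
    from that obtain z where z: "cmod z = 1" "\<And>x. blinfun_apply h x = z *\<^sub>C x"
      by (auto simp: unitary_scalars_def)
    have "blinfun_apply w (blinfun_apply w' x) = x" for x
      using arg_cong[OF that(3), of "\<lambda>f. blinfun_apply f x"] by simp
    with that(1) z show ?thesis by (auto simp: unitary_scalars_def unitary_operators_def)
  qed
  have "subgroup unitary_scalars (unitary_group :: ('h \<Rightarrow>\<^sub>L 'h) monoid)"
  proof (rule U.subgroupI)
    show "unitary_scalars \<subseteq> carrier (unitary_group :: ('h \<Rightarrow>\<^sub>L 'h) monoid)"
      using unitary_scalars_subset by (simp add: unitary_group_def)
    have "(id_blinfun :: 'h \<Rightarrow>\<^sub>L 'h) \<in> unitary_scalars"
      by (auto simp: unitary_scalars_def scaleC_one intro!: exI[of _ 1])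
    then show "(unitary_scalars :: ('h \<Rightarrow>\<^sub>L 'h) set) \<noteq> {}" by blast
  next
    fix a :: "'h \<Rightarrow>\<^sub>L 'h"
    assume a: "a \<in> unitary_scalars"
    then obtain z where z: "cmod z = 1" "\<And>x. blinfun_apply a x = z *\<^sub>C x"
      by (auto simp: unitary_scalars_def)
    have zz: "cnj z * z = 1"
      by (metis z(1) complex_norm_square mult.commute of_real_1 power_one)
    have ac: "a \<in> carrier unitary_group"
      using a unitary_scalars_subset by (auto simp: unitary_group_def)
    have "inv\<^bsub>unitary_group\<^esub> a o\<^sub>L a = id_blinfun"
      using U.l_inv[OF ac] by (simp add: unitary_group_def)
    then have "blinfun_apply (inv\<^bsub>unitary_group\<^esub> a) (blinfun_apply a x) = x" for x
      by (metis blinfun_apply_blinfun_compose blinfun_apply_id_blinfun id_apply)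
    from this[of "cnj z *\<^sub>C x" for x]
    have "blinfun_apply (inv\<^bsub>unitary_group\<^esub> a) x = cnj z *\<^sub>C x" for x
      by (simp add: z scaleC_scaleC mult.commute[of z] zz scaleC_one)
    then show "inv\<^bsub>unitary_group\<^esub> a \<in> unitary_scalars"
      using z(1) by (auto simp: unitary_scalars_def intro!: exI[of _ "cnj z"])
  next
    fix a b :: "'h \<Rightarrow>\<^sub>L 'h"
    assume "a \<in> unitary_scalars" "b \<in> unitary_scalars"
    then obtain y z where "cmod y = 1" "\<And>x. blinfun_apply a x = y *\<^sub>C x"
      "cmod z = 1" "\<And>x. blinfun_apply b x = z *\<^sub>C x"
      by (auto simp: unitary_scalars_def)
    then show "a \<otimes>\<^bsub>unitary_group\<^esub> b \<in> unitary_scalars"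
      by (auto simp: unitary_scalars_def unitary_group_def scaleC_scaleC norm_mult
          intro!: exI[of _ "y * z"])
  qed
  moreover have "\<forall>x\<in>carrier unitary_group. \<forall>h\<in>unitary_scalars.
      x \<otimes>\<^bsub>unitary_group\<^esub> h \<otimes>\<^bsub>unitary_group\<^esub> inv\<^bsub>unitary_group\<^esub> x \<in> (unitary_scalars :: ('h \<Rightarrow>\<^sub>L 'h) set)"
  proof (intro ballI)
    fix x h :: "'h \<Rightarrow>\<^sub>L 'h"
    assume "x \<in> carrier unitary_group" "h \<in> unitary_scalars"
    with U.r_inv[of x] conj[of x h "inv\<^bsub>unitary_group\<^esub> x"]
    show "x \<otimes>\<^bsub>unitary_group\<^esub> h \<otimes>\<^bsub>unitary_group\<^esub> inv\<^bsub>unitary_group\<^esub> x \<in> unitary_scalars"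
      by (simp add: unitary_group_def)
  qed
  ultimately show ?thesis by (simp add: U.normal_inv_iff)
qed

lemma group_projective_unitary_group:
  "group (projective_unitary_group :: ('h \<Rightarrow>\<^sub>L 'h::complex_hilbert_space) set monoid)"
  unfolding projective_unitary_group_def
  by (rule normal.factorgroup_is_group[OF normal_unitary_scalars])

lemma topspace_projective_unitary_topology:
  "topspace projective_unitary_topology =
     carrier (projective_unitary_group :: ('h \<Rightarrow>\<^sub>L 'h::complex_hilbert_space) set monoid)"
  by (auto simp: projective_unitary_topology_def topspace_quotient_topology unitary_topology_def
      strong_operator_topology_topspace projective_unitary_group_def FactGroup_def RCOSETS_def
      unitary_group_def)

lemma ray_scaleC: "z \<noteq> 0 \<Longrightarrow> ray (z *\<^sub>C v) = ray (v :: 'h::complex_hilbert_space)"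
proof -
  assume "z \<noteq> 0"
  then have "c *\<^sub>C v = (c / z) *\<^sub>C (z *\<^sub>C v)" for c by (simp add: scaleC_scaleC)
  then show ?thesis
    unfolding ray_def by (intro subset_antisym subsetI) (auto simp only: scaleC_scaleC)
qed

lemma topspace_projective_space_topology:
  "topspace projective_space_topology = (projective_space :: 'h::complex_hilbert_space set set)"
proof -
  have "ray v \<in> ray ` sphere 0 1" if "v \<noteq> 0" for v :: 'h
  proof -
    have "ray v = ray ((1 / norm v) *\<^sub>R v)"
      using that by (simp add: ray_scaleC flip: scaleC_of_real)
    moreover have "(1 / norm v) *\<^sub>R v \<in> sphere 0 1" using that by simp
    ultimately show ?thesis by blast
  qed
  then show ?thesis
    by (auto simp: projective_space_topology_def topspace_quotient_topology projective_space_def)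
qed

lemma projective_action_coset:
  fixes u :: "'h \<Rightarrow>\<^sub>L 'h::complex_hilbert_space"
  assumes u: "u \<in> unitary_operators"
  shows "projective_action (unitary_scalars #>\<^bsub>unitary_group\<^esub> u) (ray v) = ray (blinfun_apply u v)"
proof -
  have lin: "blinfun_apply u (c *\<^sub>C x) = c *\<^sub>C blinfun_apply u x" for c x
    using u by (simp add: unitary_operators_def)
  have one: "id_blinfun \<in> unitary_scalars"
    by (auto simp: unitary_scalars_def scaleC_one intro!: exI[of _ 1])
  have "blinfun_apply (h o\<^sub>L u) ` ray v \<subseteq> ray (blinfun_apply u v)" if "h \<in> unitary_scalars" for h
    using that by (auto simp: unitary_scalars_def ray_def lin scaleC_scaleC)
  moreover have "ray (blinfun_apply u v) \<subseteq> blinfun_apply (id_blinfun o\<^sub>L u) ` ray v"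
    by (auto simp: ray_def lin image_iff)
  moreover have "projective_action (unitary_scalars #>\<^bsub>unitary_group\<^esub> u) (ray v) =
      (\<Union>h\<in>unitary_scalars. blinfun_apply (h o\<^sub>L u) ` ray v)"
    by (simp add: projective_action_def r_coset_def unitary_group_def)
  ultimately show ?thesis
    using one by fast
qed

end

theory Submission
  imports Defs
begin

(* The lifts U g of \<pi> g are normalised by <v, U g v> >= 0, where v is a unit vector of the
   cyclic ray; continuity of the orbit map then gives U g v --> v as g --> 1. If U g w --> w and
   the ray of w' is also moved continuously, then U g w' is asymptotic to a(g) w' with
   a(g) = <w', U g w'>, and <U g w, U g w'> = <w, w'> forces a(g) --> 1 unless w and w' are
   orthogonal. Nearby points of the orbit are not orthogonal, so connectedness of G propagates
   U g w --> w from v to the whole orbit; cyclicity and the isometry property extend it to H. *)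

section \<open>Complex Hilbert spaces\<close>

lemma norm_scaleC: "norm (c *\<^sub>C x) = cmod c * norm (x :: 'h::complex_hilbert_space)"
proof -
  have "cinner (c *\<^sub>C x) (c *\<^sub>C x) = complex_of_real ((cmod c)\<^sup>2) * cinner x x"
    by (simp add: cinner_scaleC_left cinner_scaleC_right complex_norm_square mult.assoc
        del: of_real_power)
  then have "Re (cinner (c *\<^sub>C x) (c *\<^sub>C x)) = (cmod c)\<^sup>2 * Re (cinner x x)"
    by (simp only: times_complex.sel Re_complex_of_real Im_complex_of_real mult_zero_left diff_zero)
  then have "(norm (c *\<^sub>C x))\<^sup>2 = (cmod c * norm x)\<^sup>2"
    by (simp add: Re_cinner power2_norm_eq_inner power_mult_distrib)
  then show ?thesis by (simp add: power2_eq_iff_nonneg)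
qed

lemma ex_unit_rotation: "\<exists>z. cmod z = 1 \<and> z * c = complex_of_real (cmod c)"
proof (cases "c = 0")
  case False
  have "cnj c / complex_of_real (cmod c) * c = complex_of_real (cmod c)"
    using False complex_norm_square[of c] by (simp add: field_simps power2_eq_square)
  moreover have "cmod (cnj c / complex_of_real (cmod c)) = 1"
    using False by (simp add: norm_divide)
  ultimately show ?thesis by blast
qed (auto intro: exI[of _ 1])

text \<open>Rotating \<open>y\<close> by a unit phase makes the inner product real and nonnegative
  and keeps \<open>norm y\<close>, so the real Cauchy-Schwarz inequality applies.\<close>

lemma cmod_cinner_le: "cmod (cinner x y) \<le> norm x * norm (y :: 'h::complex_hilbert_space)"
proof -
  obtain z where z: "cmod z = 1" "z * cinner x y = complex_of_real (cmod (cinner x y))"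
    using ex_unit_rotation by blast
  have "cmod (cinner x y) = inner x (z *\<^sub>C y)"
    by (simp add: z(2) cinner_scaleC_right flip: Re_cinner)
  also have "\<dots> \<le> norm x * norm (z *\<^sub>C y)" by (rule norm_cauchy_schwarz)
  finally show ?thesis by (simp add: norm_scaleC z(1))
qed

lemma cinner_add_left: "cinner (x + y) z = cinner x z + cinner y (z :: 'h::complex_hilbert_space)"
  by (metis cinner_add_right cinner_commute complex_cnj_add)

lemma cinner_self: "cinner x x = complex_of_real ((norm (x :: 'h::complex_hilbert_space))\<^sup>2)"
proof (rule complex_eqI)
  have "Im (cinner x x) = - Im (cinner x x)"
    by (metis cinner_commute cnj.simps(2))
  then show "Im (cinner x x) = Im (complex_of_real ((norm x)\<^sup>2))"
    by (simp del: of_real_power)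
qed (simp add: Re_cinner power2_norm_eq_inner del: of_real_power)

text \<open>Conjugate-linearity in the first argument is still linearity over the reals, the only
  linearity asked for here. Limits and continuity of inner products follow from this.\<close>

lemma bounded_bilinear_cinner:
  "bounded_bilinear (cinner :: 'h \<Rightarrow> 'h::complex_hilbert_space \<Rightarrow> complex)"
proof
  show "cinner (r *\<^sub>R x) y = r *\<^sub>R cinner x y" for r and x y :: 'h
    by (simp add: cinner_scaleC_left scaleR_conv_of_real flip: scaleC_of_real)
  show "cinner x (r *\<^sub>R y) = r *\<^sub>R cinner x y" for r and x y :: 'h
    by (simp add: cinner_scaleC_right scaleR_conv_of_real flip: scaleC_of_real)
  show "\<exists>K. \<forall>x y :: 'h. norm (cinner x y) \<le> norm x * norm y * K"
    using cmod_cinner_le by (intro exI[of _ 1]) auto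
qed (simp_all add: cinner_add_left cinner_add_right)

lemma bounded_bilinear_scaleC:
  "bounded_bilinear (scaleC :: complex \<Rightarrow> 'h \<Rightarrow> 'h::complex_hilbert_space)"
proof
  show "(r *\<^sub>R c) *\<^sub>C x = r *\<^sub>R (c *\<^sub>C x)" for r c and x :: 'h
    by (simp add: scaleC_scaleC scaleR_conv_of_real flip: scaleC_of_real)
  show "c *\<^sub>C (r *\<^sub>R x) = r *\<^sub>R (c *\<^sub>C x)" for r c and x :: 'h
    by (simp add: scaleC_scaleC mult.commute flip: scaleC_of_real)
  show "\<exists>K. \<forall>c (x :: 'h). norm (c *\<^sub>C x) \<le> norm c * norm x * K"
    by (intro exI[of _ 1]) (simp add: norm_scaleC)
qed (simp_all add: scaleC_add_left scaleC_add_right)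

text \<open>Pythagoras: the subtracted vector is the orthogonal projection of \<open>x\<close> onto
  the line of \<open>w\<close>. Hence an overlap close to 1 forces \<open>x\<close> to be close to
  that line.\<close>

lemma norm_diff_projection:
  fixes w x :: "'h::complex_hilbert_space"
  assumes "norm w = 1" "norm x = 1"
  shows "(norm (x - cinner w x *\<^sub>C w))\<^sup>2 = 1 - (cmod (cinner w x))\<^sup>2"
proof -
  interpret bounded_bilinear "cinner :: 'h \<Rightarrow> 'h \<Rightarrow> complex" by (rule bounded_bilinear_cinner)
  let ?a = "cinner w x"
  have "cinner x w = cnj ?a" by (rule cinner_commute)
  then have "complex_of_real ((norm (x - ?a *\<^sub>C w))\<^sup>2) = 1 - ?a * cnj ?a"
    unfolding cinner_self[symmetric]
    by (simp add: diff_left diff_right cinner_scaleC_left cinner_scaleC_right cinner_self[of w]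
        cinner_self[of x] assms algebra_simps del: of_real_power)
  also have "\<dots> = complex_of_real (1 - (cmod ?a)\<^sup>2)"
    by (simp add: complex_norm_square del: of_real_power)
  finally show ?thesis by (simp only: of_real_eq_iff)
qed

text \<open>The limit of overlaps controls the ray of \<open>w'\<close> only; the phase left free is
  pinned by comparison with \<open>w\<close>, with \<open>cinner w w'\<close> as the divisor at the
  end.\<close>

lemma tendsto_of_tendsto_nonorthogonal:
  fixes U :: "'a \<Rightarrow> 'h \<Rightarrow>\<^sub>L 'h::complex_hilbert_space"
  assumes U: "\<forall>\<^sub>F g in F. U g \<in> unitary_operators"
    and w: "((\<lambda>g. blinfun_apply (U g) w) \<longlongrightarrow> w) F"
    and w': "((\<lambda>g. cmod (cinner w' (blinfun_apply (U g) w'))) \<longlongrightarrow> 1) F"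
    and unit: "norm w' = 1"
    and nonorth: "cinner w w' \<noteq> 0"
  shows "((\<lambda>g. blinfun_apply (U g) w') \<longlongrightarrow> w') F"
proof -
  interpret cinner: bounded_bilinear "cinner :: 'h \<Rightarrow> 'h \<Rightarrow> complex"
    by (rule bounded_bilinear_cinner)
  interpret scaleC: bounded_bilinear "scaleC :: complex \<Rightarrow> 'h \<Rightarrow> 'h"
    by (rule bounded_bilinear_scaleC)
  \<comment> \<open>\<open>a g\<close> is the coefficient of the projection of \<open>U g w'\<close>
    onto the line of \<open>w'\<close>, and \<open>d g\<close> is the orthogonal remainder.\<close>
  define a where "a g = cinner w' (blinfun_apply (U g) w')" for g
  define d where "d g = blinfun_apply (U g) w' - a g *\<^sub>C w'" for g
  have "((\<lambda>g. sqrt (1 - (cmod (a g))\<^sup>2)) \<longlongrightarrow> sqrt (1 - 1\<^sup>2)) F"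
    unfolding a_def by (intro tendsto_intros w')
  moreover have "\<forall>\<^sub>F g in F. sqrt (1 - (cmod (a g))\<^sup>2) = norm (d g)"
    using U
  proof eventually_elim
    case (elim g)
    then have "(norm (d g))\<^sup>2 = 1 - (cmod (a g))\<^sup>2"
      unfolding d_def a_def by (intro norm_diff_projection unit) (simp add: norm_unitary unit)
    then show ?case by (metis norm_ge_zero real_sqrt_abs abs_of_nonneg)
  qed
  ultimately have "((\<lambda>g. norm (d g)) \<longlongrightarrow> 0) F"
    by (auto elim: Lim_transform_eventually)
  then have d: "(d \<longlongrightarrow> 0) F" by (rule tendsto_norm_zero_cancel)
  have "((\<lambda>g. cmod (cinner (blinfun_apply (U g) w - w) (blinfun_apply (U g) w'))) \<longlongrightarrow> 0) F"
  proof (rule tendsto_0_le[where K = 1])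
    show "((\<lambda>g. blinfun_apply (U g) w - w) \<longlongrightarrow> 0) F" using w by (rule LIM_zero)
    show "\<forall>\<^sub>F g in F. norm (cmod (cinner (blinfun_apply (U g) w - w) (blinfun_apply (U g) w')))
        \<le> norm (blinfun_apply (U g) w - w) * 1"
      using U
    proof eventually_elim
      case (elim g)
      then have "norm (blinfun_apply (U g) w') = 1" by (simp add: norm_unitary unit)
      then show ?case
        using cmod_cinner_le[of "blinfun_apply (U g) w - w" "blinfun_apply (U g) w'"] by simp
    qed
  qed
  then have "((\<lambda>g. cinner (blinfun_apply (U g) w - w) (blinfun_apply (U g) w') + cinner w (d g))
      \<longlongrightarrow> 0 + cinner w 0) F"
    by (intro tendsto_add cinner.tendsto tendsto_const d) (simp add: tendsto_norm_zero_iff)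
  \<comment> \<open>After expansion the two mixed terms \<open>cinner w (U g w')\<close> cancel, and
    unitarity turns \<open>cinner (U g w) (U g w')\<close> into \<open>cinner w w'\<close>.\<close>
  moreover have "\<forall>\<^sub>F g in F. cinner (blinfun_apply (U g) w - w) (blinfun_apply (U g) w')
      + cinner w (d g) = (1 - a g) * cinner w w'"
    using U
  proof eventually_elim
    case (elim g)
    then have "cinner (blinfun_apply (U g) w) (blinfun_apply (U g) w') = cinner w w'"
      by (simp add: unitary_operators_def)
    then show ?case
      by (simp add: d_def cinner.diff_left cinner.diff_right cinner_scaleC_right algebra_simps)
  qed
  ultimately have "((\<lambda>g. (1 - a g) * cinner w w') \<longlongrightarrow> 0) F"
    by (auto simp: cinner.zero_right elim: Lim_transform_eventually)
  then have "((\<lambda>g. 1 - (1 - a g) * cinner w w' / cinner w w') \<longlongrightarrow> 1 - 0 / cinner w w') F"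
    by (intro tendsto_intros nonorth)
  then have "(a \<longlongrightarrow> 1) F" by (simp add: nonorth)
  then have "((\<lambda>g. d g + a g *\<^sub>C w') \<longlongrightarrow> 0 + 1 *\<^sub>C w') F"
    by (intro tendsto_add d scaleC.tendsto tendsto_const)
  then show ?thesis by (simp add: d_def scaleC_one)
qed

text \<open>Linearity gives the limit on the span. Each \<open>U g\<close> is an isometry, so the
  approximation error is the same for all \<open>g\<close> and an e/3 argument reaches the
  closure.\<close>

lemma tendsto_closure_span:
  fixes U :: "'a \<Rightarrow> 'h \<Rightarrow>\<^sub>L 'h::complex_hilbert_space"
  assumes U: "\<forall>\<^sub>F g in F. U g \<in> unitary_operators"
    and S: "\<And>x. x \<in> S \<Longrightarrow> ((\<lambda>g. blinfun_apply (U g) x) \<longlongrightarrow> x) F"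
    and x: "x \<in> closure (complex_vector.span S)"
  shows "((\<lambda>g. blinfun_apply (U g) x) \<longlongrightarrow> x) F"
proof -
  interpret scaleC: bounded_bilinear "scaleC :: complex \<Rightarrow> 'h \<Rightarrow> 'h"
    by (rule bounded_bilinear_scaleC)
  have span: "((\<lambda>g. blinfun_apply (U g) y) \<longlongrightarrow> y) F" if "y \<in> complex_vector.span S" for y
    using that
  proof (induction rule: complex_vector.span_induct_alt)
    case (step c x y)
    have "((\<lambda>g. c *\<^sub>C blinfun_apply (U g) x + blinfun_apply (U g) y) \<longlongrightarrow> c *\<^sub>C x + y) F"
      by (intro tendsto_add scaleC.tendsto tendsto_const S step)
    moreover have "\<forall>\<^sub>F g in F. c *\<^sub>C blinfun_apply (U g) x + blinfun_apply (U g) y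
        = blinfun_apply (U g) (c *\<^sub>C x + y)"
      using U by eventually_elim (simp add: unitary_operators_def blinfun.add_right)
    ultimately show ?case by (rule Lim_transform_eventually)
  qed (simp add: blinfun.zero_right)
  show ?thesis
  proof (rule tendstoI)
    fix e :: real assume "e > 0"
    then obtain y where y: "y \<in> complex_vector.span S" "dist y x < e / 3"
      using x unfolding closure_approachable by (metis zero_less_divide_iff zero_less_numeral)
    have "\<forall>\<^sub>F g in F. dist (blinfun_apply (U g) y) y < e / 3"
      using span[OF y(1)] \<open>e > 0\<close> by (intro tendstoD) auto
    with U show "\<forall>\<^sub>F g in F. dist (blinfun_apply (U g) x) x < e"
    proof eventually_elim
      case (elim g)
      have "dist (blinfun_apply (U g) x) (blinfun_apply (U g) y) = dist x y"
        by (metis blinfun.diff_right dist_norm elim(1) norm_unitary)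
      then show ?case
        using elim(2) y(2) dist_triangle[of "blinfun_apply (U g) x" x y]
          dist_triangle[of "blinfun_apply (U g) x" y "blinfun_apply (U g) y"]
        by (simp add: dist_commute)
    qed
  qed
qed

section \<open>Limits and topologies\<close>

lemma tendsto_nhdsin:
  assumes f: "continuous_map X euclidean f" and a: "a \<in> topspace X"
  shows "(f \<longlongrightarrow> f a) (nhdsin X a)"
proof (rule topological_tendstoI)
  fix S assume "open S" "f a \<in> S"
  then show "\<forall>\<^sub>F x in nhdsin X a. f x \<in> S"
    using openin_continuous_map_preimage[OF f, of S] a by (auto simp: eventually_nhdsin)
qed

text \<open>The strong operator topology is pulled back from the product topology on functions, so a
  basic neighbourhood of \<open>u\<close> constrains only finitely many vectors, and pointwise
  limits suffice.\<close>

lemma eventually_strong_operator_topology: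
  fixes U :: "'a \<Rightarrow> 'b::real_normed_vector \<Rightarrow>\<^sub>L 'c::real_normed_vector"
  assumes lim: "\<And>x. ((\<lambda>g. blinfun_apply (U g) x) \<longlongrightarrow> blinfun_apply u x) F"
    and W: "openin strong_operator_topology W" "u \<in> W"
  shows "\<forall>\<^sub>F g in F. U g \<in> W"
proof -
  obtain A where A: "open A" and WA: "W = blinfun_apply -` A"
    using W(1) by (auto simp: strong_operator_topology_def openin_pullback_topology)
  have "openin (product_topology (\<lambda>_. euclidean) UNIV) A"
    using A by (simp add: euclidean_product_topology)
  then obtain X where X: "blinfun_apply u \<in> PiE UNIV X" "\<And>i. open (X i)"
      "finite {i. X i \<noteq> UNIV}" "PiE UNIV X \<subseteq> A"
    using product_topology_open_contains_basis[of "\<lambda>_. euclidean" UNIV A "blinfun_apply u"] W(2) WA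
    by auto
  have "\<forall>\<^sub>F g in F. \<forall>i\<in>{i. X i \<noteq> UNIV}. blinfun_apply (U g) i \<in> X i"
  proof (rule eventually_ball_finite[OF X(3)], rule ballI)
    fix i show "\<forall>\<^sub>F g in F. blinfun_apply (U g) i \<in> X i"
      using X(1) by (intro topological_tendstoD[OF lim X(2)]) auto
  qed
  then show ?thesis
  proof eventually_elim
    case (elim g)
    then have "blinfun_apply (U g) \<in> PiE UNIV X" by auto
    then show ?case using X(4) WA by auto
  qed
qed

text \<open>For a unit vector \<open>w\<close> this is the square root of the quantum transition
  probability. The choice is harmless: unit vectors of one ray differ by a phase, which the modulus
  ignores.\<close>

definition ray_overlap :: "'h::complex_hilbert_space \<Rightarrow> 'h set \<Rightarrow> real" where
  "ray_overlap w l = cmod (cinner w (SOME x. x \<in> l \<and> norm x = 1))"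

lemma ray_overlap_ray:
  assumes "norm v = 1"
  shows "ray_overlap w (ray v) = cmod (cinner w v)"
proof -
  define x where "x = (SOME x. x \<in> ray v \<and> norm x = 1)"
  have "v \<in> ray v" unfolding ray_def by (metis rangeI scaleC_one)
  then have x: "x \<in> ray v \<and> norm x = 1"
    unfolding x_def using assms by (intro someI[of "\<lambda>x. x \<in> ray v \<and> norm x = 1"]) simp
  then obtain z where "x = z *\<^sub>C v" by (auto simp: ray_def)
  with x assms have "cmod (cinner w x) = cmod (cinner w v)"
    by (simp add: cinner_scaleC_right norm_mult norm_scaleC)
  then show ?thesis by (simp add: ray_overlap_def x_def)
qed

text \<open>By the universal property of the quotient, continuity need only be checked on the unit
  sphere, where the function is the modulus of an inner product.\<close>

lemma continuous_map_ray_overlap: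
  "continuous_map projective_space_topology euclideanreal (ray_overlap w)"
  unfolding projective_space_topology_def
proof (rule continuous_compose_quotient_map[OF quotient_map_quotient_topology])
  interpret bounded_bilinear "cinner :: 'a \<Rightarrow> 'a \<Rightarrow> complex" by (rule bounded_bilinear_cinner)
  have "continuous_on (sphere 0 1) (\<lambda>x. cmod (cinner w x))"
    by (intro continuous_intros continuous_on)
  then have "continuous_on (sphere 0 1) (ray_overlap w \<circ> ray)"
    by (rule continuous_on_eq) (simp add: ray_overlap_ray)
  then show "continuous_map (top_of_set (sphere 0 1)) euclideanreal (ray_overlap w \<circ> ray)"
    by simp
qed

section \<open>Projective unitary representations\<close>

text \<open>Any representative of the coset may be multiplied by the phase that makes its diagonal
  entry at \<open>v\<close> real and nonnegative; the coset does not change.\<close>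

lemma ex_normalised_lift:
  assumes "A \<in> carrier projective_unitary_group"
  shows "\<exists>u\<in>unitary_operators. A = unitary_scalars #>\<^bsub>unitary_group\<^esub> u \<and>
    cinner v (blinfun_apply u v) = complex_of_real (cmod (cinner v (blinfun_apply u v)))"
proof -
  interpret normal unitary_scalars "unitary_group :: ('a \<Rightarrow>\<^sub>L 'a) monoid"
    by (rule normal_unitary_scalars)
  obtain u where u: "u \<in> unitary_operators" and A: "A = unitary_scalars #>\<^bsub>unitary_group\<^esub> u"
    using assms by (auto simp: projective_unitary_group_def FactGroup_def RCOSETS_def unitary_group_def)
  obtain z where z: "cmod z = 1"
      "z * cinner v (blinfun_apply u v) = complex_of_real (cmod (cinner v (blinfun_apply u v)))"
    using ex_unit_rotation by blast
  define s where "s = Blinfun (\<lambda>x :: 'a. z *\<^sub>C x)"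
  have s: "blinfun_apply s x = z *\<^sub>C x" for x
    by (simp add: s_def bounded_linear_Blinfun_apply bounded_linear_scaleC)
  then have "s \<in> unitary_scalars" using z(1) by (auto simp: unitary_scalars_def)
  then have mem: "s o\<^sub>L u \<in> unitary_scalars #>\<^bsub>unitary_group\<^esub> u"
    by (auto simp: r_coset_def unitary_group_def)
  have uc: "u \<in> carrier unitary_group" using u by (simp add: unitary_group_def)
  have "s o\<^sub>L u \<in> unitary_operators"
    using r_coset_subset_G[OF subset uc] mem by (auto simp: unitary_group_def)
  moreover have "A = unitary_scalars #>\<^bsub>unitary_group\<^esub> (s o\<^sub>L u)"
    using repr_independence[OF mem uc is_subgroup] A by simp
  moreover have "cinner v (blinfun_apply (s o\<^sub>L u) v) = complex_of_real (cmod (cinner v (blinfun_apply (s o\<^sub>L u) v)))"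
    using z(2) by (simp add: s cinner_scaleC_right)
  ultimately show ?thesis by blast
qed

lemma (in topological_group) continuous_map_mult_left:
  assumes "a \<in> carrier G"
  shows "continuous_map T T (\<lambda>x. a \<otimes> x)"
proof -
  have "continuous_map T (prod_topology T T) (\<lambda>x. (a, x))"
    using assms by (simp add: continuous_map_paired topspace_eq_carrier)
  from continuous_map_compose[OF this continuous_mult] show ?thesis by (simp add: comp_def)
qed

lemma (in topological_group) continuous_map_mult_right:
  assumes "a \<in> carrier G"
  shows "continuous_map T T (\<lambda>x. x \<otimes> a)"
proof -
  have "continuous_map T (prod_topology T T) (\<lambda>x. (x, a))"
    using assms by (simp add: continuous_map_paired topspace_eq_carrier)
  from continuous_map_compose[OF this continuous_mult] show ?thesis by (simp add: comp_def)
qed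

theorem theorem4p15:
  fixes G :: "('g, 'm) monoid_scheme"
    and T :: "'g topology"
    and \<pi> :: "'g \<Rightarrow> ('h \<Rightarrow>\<^sub>L 'h::complex_hilbert_space) set"
  assumes "topological_group G T"
    and "connected_space T"
    and "\<pi> \<in> hom G projective_unitary_group"
    and "\<exists>l \<in> projective_space.
           cyclic_ray G \<pi> l \<and>
           continuous_map T projective_space_topology (\<lambda>g. projective_action (\<pi> g) l)"
  shows "continuous_map T projective_unitary_topology \<pi>"
proof -
  interpret topological_group G T by fact
  interpret N: normal unitary_scalars "unitary_group :: ('h \<Rightarrow>\<^sub>L 'h) monoid"
    by (rule normal_unitary_scalars)
  interpret cinner: bounded_bilinear "cinner :: 'h \<Rightarrow> 'h \<Rightarrow> complex"
    by (rule bounded_bilinear_cinner)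
  let ?q = "\<lambda>u :: 'h \<Rightarrow>\<^sub>L 'h. unitary_scalars #>\<^bsub>unitary_group\<^esub> u"
  note [simp] = topspace_eq_carrier
  \<comment> \<open>The projective space is the image of the unit sphere, so the given ray has a
    unit representative.\<close>
  obtain v :: 'h where v: "norm v = 1" and cyc: "cyclic_ray G \<pi> (ray v)"
    and cont: "continuous_map T projective_space_topology (\<lambda>g. projective_action (\<pi> g) (ray v))"
    using assms(4) unfolding topspace_projective_space_topology[symmetric]
    by (auto simp: projective_space_topology_def topspace_quotient_topology)

  \<comment> \<open>Normalised lifts and their overlaps\<close>
  have carrier: "\<pi> g \<in> carrier projective_unitary_group" if "g \<in> carrier G" for g
    using assms(3) that by (auto simp: hom_def)
  then have "\<forall>g. \<exists>u. g \<in> carrier G \<longrightarrow> u \<in> unitary_operators \<and> \<pi> g = ?q u \<and>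
      cinner v (blinfun_apply u v) = complex_of_real (cmod (cinner v (blinfun_apply u v)))"
    using ex_normalised_lift by blast
  then obtain U where U: "\<And>g. g \<in> carrier G \<Longrightarrow> U g \<in> unitary_operators"
    and q: "\<And>g. g \<in> carrier G \<Longrightarrow> \<pi> g = ?q (U g)"
    and pos: "\<And>g. g \<in> carrier G \<Longrightarrow> cinner v (blinfun_apply (U g) v)
        = complex_of_real (cmod (cinner v (blinfun_apply (U g) v)))"
    by metis
  \<comment> \<open>The lifts are chosen independently for each \<open>g\<close>, so
    \<open>U\<close> is multiplicative only up to a phase; the cosets do not see it.\<close>
  have \<pi>_mult: "\<pi> (g \<otimes>\<^bsub>G\<^esub> h) = ?q (U g o\<^sub>L U h)" if g: "g \<in> carrier G" and h: "h \<in> carrier G" for g h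
  proof -
    have "\<pi> (g \<otimes>\<^bsub>G\<^esub> h) = ?q (U g) <#>\<^bsub>unitary_group\<^esub> ?q (U h)"
      using assms(3) g h
      by (simp add: hom_mult q projective_unitary_group_def FactGroup_def)
    also have "\<dots> = ?q (U g o\<^sub>L U h)"
      using N.rcos_sum[of "U g" "U h"] U[OF g] U[OF h] by (simp add: unitary_group_def)
    finally show ?thesis .
  qed
  have action: "projective_action (\<pi> g) (ray v) = ray (blinfun_apply (U g) v)"
    if "g \<in> carrier G" for g
    using projective_action_coset[OF U[OF that]] that by (simp add: q)
  have norm: "norm (blinfun_apply (U g) v) = 1" if "g \<in> carrier G" for g
    using norm_unitary[OF U[OF that]] v by simp
  \<comment> \<open>Continuity of the orbit map enters the proof only through these real-valued
    functions.\<close>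
  have overlap: "continuous_map T euclideanreal (\<lambda>g. cmod (cinner w (blinfun_apply (U g) v)))" for w
  proof (rule continuous_map_eq)
    show "continuous_map T euclideanreal (ray_overlap w \<circ> (\<lambda>g. projective_action (\<pi> g) (ray v)))"
      by (rule continuous_map_compose[OF cont continuous_map_ray_overlap])
  qed (simp add: action ray_overlap_ray norm)
  have overlap_mult: "cmod (cinner w (blinfun_apply (U (g \<otimes>\<^bsub>G\<^esub> h)) v))
      = cmod (cinner w (blinfun_apply (U g) (blinfun_apply (U h) v)))"
    if g: "g \<in> carrier G" and h: "h \<in> carrier G" for w g h
  proof -
    have "U g o\<^sub>L U h \<in> unitary_operators"
      using N.m_closed[of "U g" "U h"] U[OF g] U[OF h] by (simp add: unitary_group_def)
    from projective_action_coset[OF this, of v] \<pi>_mult[OF g h] action[of "g \<otimes>\<^bsub>G\<^esub> h"] g h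
    have "ray (blinfun_apply (U (g \<otimes>\<^bsub>G\<^esub> h)) v) = ray (blinfun_apply (U g) (blinfun_apply (U h) v))"
      by simp
    then show ?thesis
      using norm[of "g \<otimes>\<^bsub>G\<^esub> h"] norm[OF h] norm_unitary[OF U[OF g]] g h
      by (metis m_closed ray_overlap_ray)
  qed

  \<comment> \<open>Behaviour of the lifts near the identity\<close>
  define F where "F = nhdsin T \<one>\<^bsub>G\<^esub>"
  have in_carrier: "\<forall>\<^sub>F g in F. g \<in> carrier G"
    unfolding F_def eventually_nhdsin using openin_topspace[of T] by auto
  then have UF: "\<forall>\<^sub>F g in F. U g \<in> unitary_operators"
    by eventually_elim (rule U)
  \<comment> \<open>Right translation by \<open>h\<close> moves the base point of the orbit from
    \<open>v\<close> to \<open>U h v\<close>; at the identity the overlap is the squared norm of a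
    unit vector.\<close>
  have overlap_tendsto: "((\<lambda>g. cmod (cinner (blinfun_apply (U h) v)
      (blinfun_apply (U g) (blinfun_apply (U h) v)))) \<longlongrightarrow> 1) F" if h: "h \<in> carrier G" for h
  proof (rule Lim_transform_eventually)
    let ?w = "blinfun_apply (U h) v"
    have "continuous_map T euclideanreal ((\<lambda>g. cmod (cinner ?w (blinfun_apply (U g) v))) \<circ> (\<lambda>g. g \<otimes>\<^bsub>G\<^esub> h))"
      by (rule continuous_map_compose[OF continuous_map_mult_right[OF h] overlap])
    from tendsto_nhdsin[OF this, of "\<one>\<^bsub>G\<^esub>"]
    show "((\<lambda>g. cmod (cinner ?w (blinfun_apply (U (g \<otimes>\<^bsub>G\<^esub> h)) v))) \<longlongrightarrow> 1) F"
      using h norm[OF h] by (simp add: F_def cinner_self comp_def)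
    show "\<forall>\<^sub>F g in F. cmod (cinner ?w (blinfun_apply (U (g \<otimes>\<^bsub>G\<^esub> h)) v))
        = cmod (cinner ?w (blinfun_apply (U g) ?w))"
      using in_carrier by eventually_elim (simp add: overlap_mult h)
  qed
  \<comment> \<open>The lift of the identity is a phase, and the normalisation at \<open>v\<close>
    forces that phase to be 1. So \<open>v\<close> itself is the orbit vector belonging to the
    identity.\<close>
  have "U \<one>\<^bsub>G\<^esub> \<in> unitary_scalars"
  proof -
    have "\<pi> \<one>\<^bsub>G\<^esub> = \<one>\<^bsub>projective_unitary_group\<^esub>"
      by (rule hom_one[OF assms(3) is_group group_projective_unitary_group])
    then have "?q (U \<one>\<^bsub>G\<^esub>) = unitary_scalars"
      by (simp add: q projective_unitary_group_def FactGroup_def)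
    moreover have "U \<one>\<^bsub>G\<^esub> \<in> ?q (U \<one>\<^bsub>G\<^esub>)"
      using N.rcos_self[OF _ N.is_subgroup, of "U \<one>\<^bsub>G\<^esub>"] U[of "\<one>\<^bsub>G\<^esub>"] by (simp add: unitary_group_def)
    ultimately show ?thesis by simp
  qed
  then obtain z where z: "cmod z = 1" "\<And>x. blinfun_apply (U \<one>\<^bsub>G\<^esub>) x = z *\<^sub>C x"
    by (auto simp: unitary_scalars_def)
  have "z = 1"
    using pos[of "\<one>\<^bsub>G\<^esub>"] by (simp add: z cinner_scaleC_right cinner_self v norm_mult)
  then have U1: "blinfun_apply (U \<one>\<^bsub>G\<^esub>) x = x" for x by (simp add: z scaleC_one)

  \<comment> \<open>Propagation along the orbit by connectedness\<close>
  define S where "S = {h \<in> carrier G. ((\<lambda>g. blinfun_apply (U g) (blinfun_apply (U h) v))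
      \<longlongrightarrow> blinfun_apply (U h) v) F}"
  have base: "((\<lambda>g. blinfun_apply (U g) v) \<longlongrightarrow> v) F"
  proof -
    \<comment> \<open>The squared distance is 2 - 2 Re \<open>cinner v (U g v)\<close>. The
      normalisation identifies this real part with the modulus, whose limit is known to be
      1.\<close>
    let ?c = "\<lambda>g. cmod (cinner v (blinfun_apply (U g) v))"
    have "((\<lambda>g. sqrt (2 - 2 * ?c g)) \<longlongrightarrow> sqrt (2 - 2 * 1)) F"
      using overlap_tendsto[of "\<one>\<^bsub>G\<^esub>"] by (intro tendsto_intros) (simp add: U1)
    moreover have "\<forall>\<^sub>F g in F. sqrt (2 - 2 * ?c g) = norm (blinfun_apply (U g) v - v)"
      using in_carrier
    proof eventually_elim
      case (elim g)
      have "inner v (blinfun_apply (U g) v) = ?c g"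
        using pos[OF elim] by (metis Re_cinner Re_complex_of_real)
      then have "(norm (blinfun_apply (U g) v - v))\<^sup>2 = 2 - 2 * ?c g"
        using norm[OF elim] v
        by (simp add: power2_norm_eq_inner inner_diff inner_commute norm_eq_1)
      then show ?case by (metis norm_ge_zero real_sqrt_abs abs_of_nonneg)
    qed
    ultimately have "((\<lambda>g. norm (blinfun_apply (U g) v - v)) \<longlongrightarrow> 0) F"
      by (auto elim: Lim_transform_eventually)
    then show ?thesis by (rule LIM_zero_cancel[OF tendsto_norm_zero_cancel])
  qed
  then have S1: "\<one>\<^bsub>G\<^esub> \<in> S" by (simp add: S_def U1)
  \<comment> \<open>Nonorthogonality to \<open>U h v\<close> is written as a preimage of the open
    half-line, so that continuity of the overlaps makes \<open>N h\<close> an open neighbourhood of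
    \<open>h\<close>.\<close>
  define N where "N h = {h' \<in> carrier G. cmod (cinner (blinfun_apply (U h) v)
      (blinfun_apply (U h') v)) \<in> {0<..}}" for h
  have N_open: "openin T (N h)" for h
    using openin_continuous_map_preimage[OF overlap, of "{0<..}"] by (simp add: N_def)
  have N_self: "h \<in> N h" if "h \<in> carrier G" for h
    using norm[OF that] that by (simp add: N_def cinner_self)
  \<comment> \<open>Nonorthogonality is symmetric, so convergence passes both ways. Membership in
    \<open>S\<close> is thus constant on \<open>N h\<close>, which makes both \<open>S\<close> and
    its complement open.\<close>
  have N_S: "h \<in> S \<longleftrightarrow> h' \<in> S" if "h \<in> carrier G" "h' \<in> N h" for h h'
  proof -
    have h': "h' \<in> carrier G" using that by (simp add: N_def)
    have ne: "cinner (blinfun_apply (U h) v) (blinfun_apply (U h') v) \<noteq> 0"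
      using that by (simp add: N_def)
    then have "cinner (blinfun_apply (U h') v) (blinfun_apply (U h) v) \<noteq> 0"
      by (metis cinner_commute complex_cnj_zero)
    with ne show ?thesis
      using tendsto_of_tendsto_nonorthogonal[OF UF _ overlap_tendsto norm] that(1) h'
      unfolding S_def by blast
  qed
  have "openin T S"
  proof (subst openin_subopen, intro ballI)
    fix h assume h: "h \<in> S"
    then have "h \<in> carrier G" by (simp add: S_def)
    moreover from this have "N h \<subseteq> S" using N_S[of h] h by blast
    ultimately show "\<exists>V. openin T V \<and> h \<in> V \<and> V \<subseteq> S"
      using N_open N_self[of h] by blast
  qed
  moreover have "openin T (topspace T - S)"
  proof (subst openin_subopen, intro ballI)
    fix h assume h: "h \<in> topspace T - S"
    then have "N h \<subseteq> topspace T - S" using N_S[of h] by (auto simp: N_def)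
    then show "\<exists>V. openin T V \<and> h \<in> V \<and> V \<subseteq> topspace T - S"
      using N_open N_self[of h] h by auto
  qed
  moreover have "S \<subseteq> carrier G" by (auto simp: S_def)
  ultimately have "S = carrier G"
    using assms(2) S1 unfolding connected_space_clopen_in closedin_def by auto
  then have orbit: "((\<lambda>g. blinfun_apply (U g) (blinfun_apply (U h) v)) \<longlongrightarrow> blinfun_apply (U h) v) F"
    if "h \<in> carrier G" for h
    using that by (auto simp: S_def)

  \<comment> \<open>Strong convergence on the whole space\<close>
  have lim: "((\<lambda>g. blinfun_apply (U g) x) \<longlongrightarrow> x) F" for x
  proof (rule tendsto_closure_span[OF UF])
    show "x \<in> closure (complex_vector.span (\<Union>g\<in>carrier G. projective_action (\<pi> g) (ray v)))"
      using cyc by (simp add: cyclic_ray_def)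
  next
    fix y assume "y \<in> (\<Union>g\<in>carrier G. projective_action (\<pi> g) (ray v))"
    then obtain h c where h: "h \<in> carrier G" and y: "y = c *\<^sub>C blinfun_apply (U h) v"
      by (force simp: action image_iff ray_def[of "blinfun_apply _ v"])
    \<comment> \<open>The span of a single orbit vector carries convergence from that vector to its
      whole ray, since cyclicity is stated for rays as sets.\<close>
    have "y \<in> closure (complex_vector.span {blinfun_apply (U h) v})"
      unfolding y
      by (intro subsetD[OF closure_subset] complex_vector.span_scale complex_vector.span_base) simp
    then show "((\<lambda>g. blinfun_apply (U g) y) \<longlongrightarrow> y) F"
      by (rule tendsto_closure_span[OF UF, rotated]) (use orbit[OF h] in auto)
  qed

  \<comment> \<open>Continuity into the quotient group\<close>
  show ?thesis
    unfolding continuous_map_def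
  proof (intro conjI allI impI)
    show "\<pi> \<in> topspace T \<rightarrow> topspace projective_unitary_topology"
      using carrier by (simp add: topspace_projective_unitary_topology)
    fix Q :: "('h \<Rightarrow>\<^sub>L 'h) set set" assume Q: "openin projective_unitary_topology Q"
    show "openin T {g \<in> topspace T. \<pi> g \<in> Q}"
    proof (subst openin_subopen, intro ballI)
      fix a assume "a \<in> {g \<in> topspace T. \<pi> g \<in> Q}"
      then have a: "a \<in> carrier G" "\<pi> a \<in> Q" by auto
      have "openin unitary_topology {u \<in> unitary_operators. ?q u \<in> Q}"
        using Q by (simp add: projective_unitary_topology_def openin_quotient_topology
            unitary_topology_def strong_operator_topology_topspace)
      then obtain W where W: "openin strong_operator_topology W"
          "{u \<in> unitary_operators. ?q u \<in> Q} = W \<inter> unitary_operators"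
        by (auto simp: unitary_topology_def openin_subtopology)
      have "U a \<in> W" using W(2) U[OF a(1)] a by (auto simp: q)
      \<comment> \<open>The product of the lifts of \<open>a\<close> and \<open>g\<close> represents
        the coset of their product and converges strongly to \<open>U a\<close>; the chosen lift of
        the product may differ from it by a phase of which nothing is known.\<close>
      moreover have "((\<lambda>g. blinfun_apply (U a o\<^sub>L U g) x) \<longlongrightarrow> blinfun_apply (U a) x) F" for x
        using lim[of x] by (auto intro!: tendsto_intros)
      ultimately have "\<forall>\<^sub>F g in F. U a o\<^sub>L U g \<in> W"
        by (intro eventually_strong_operator_topology W(1)) auto
      with in_carrier have "\<forall>\<^sub>F g in F. g \<in> carrier G \<and> \<pi> (a \<otimes>\<^bsub>G\<^esub> g) \<in> Q"
      proof eventually_elim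
        case (elim g)
        have "U a o\<^sub>L U g \<in> unitary_operators"
          using N.m_closed[of "U a" "U g"] U[OF a(1)] U[OF elim(1)] by (simp add: unitary_group_def)
        then show ?case using elim W(2) \<pi>_mult[OF a(1) elim(1)] by auto
      qed
      then obtain V where V: "openin T V" "\<one>\<^bsub>G\<^esub> \<in> V" "\<And>g. g \<in> V \<Longrightarrow> \<pi> (a \<otimes>\<^bsub>G\<^esub> g) \<in> Q"
        by (auto simp: F_def eventually_nhdsin)
      \<comment> \<open>The neighbourhood \<open>V\<close> of the identity is carried to
        \<open>a\<close> by left translation.\<close>
      let ?V = "{g \<in> topspace T. inv\<^bsub>G\<^esub> a \<otimes>\<^bsub>G\<^esub> g \<in> V}"
      have "openin T ?V"
        by (rule openin_continuous_map_preimage[OF continuous_map_mult_left V(1)]) (simp add: a)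
      moreover have "a \<in> ?V" using a V(2) by simp
      moreover have "?V \<subseteq> {g \<in> topspace T. \<pi> g \<in> Q}"
      proof safe
        fix g assume g: "g \<in> topspace T" "inv\<^bsub>G\<^esub> a \<otimes>\<^bsub>G\<^esub> g \<in> V"
        then have "a \<otimes>\<^bsub>G\<^esub> (inv\<^bsub>G\<^esub> a \<otimes>\<^bsub>G\<^esub> g) = g"
          using a(1) by (simp flip: m_assoc)
        then show "\<pi> g \<in> Q" using V(3)[OF g(2)] by simp
      qed
      ultimately show "\<exists>V. openin T V \<and> a \<in> V \<and> V \<subseteq> {g \<in> topspace T. \<pi> g \<in> Q}" by blast
    qed
  qed
qed

end
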